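(* If $\pi$ is a finitely generated torsion free nilpotent group, then $\pi$ satisfies Property $N$ and therefore $\pi$ is principal.
   Context: For a subset $S$ of a group $\pi$, $Z(S)$ denotes its centraliser in $\pi$. A group $\pi$ satisfies Property $N$ if for any $a\in\pi$ and any finite set $S\subset\pi$, $a^n\in Z(S)$ for some $n\ge1$ implies $a\in Z(S)$. Let $\mathcal D$ be the smallest set of subgroups of $\pi\times\pi$ which contains the trivial subgroup and the diagonal $\Delta=\{(a,a):a\in\pi\}$ and is closed under conjugation and finite intersections. (Its nontrivial members have the form $\{(a,bab^{-1}):a\in Z(S)\}$ with $b\in\pi$, $S\subset\pi$ finite.) The group $\pi$ is called principal if for any two subgroups $H,H'\in\mathcal D$ the index $[H:H\cap H']$ is either $1$ or infinite. For torsion free $\pi$ this is equivalent to: for any two finite subsets $S,S'\subset\pi$ the index $[Z(S):Z(S\cup S')]$ is either $1$ or infinite. *)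

theory Defs
  imports "HOL-Algebra.Algebra"
begin

definition centraliser :: "('a, 'b) monoid_scheme \<Rightarrow> 'a set \<Rightarrow> 'a set" where
  "centraliser G S = {a \<in> carrier G. \<forall>s\<in>S. a \<otimes>\<^bsub>G\<^esub> s = s \<otimes>\<^bsub>G\<^esub> a}"

definition finitely_generated_group :: "('a, 'b) monoid_scheme \<Rightarrow> bool" where
  "finitely_generated_group G \<longleftrightarrow>
     (\<exists>S. finite S \<and> S \<subseteq> carrier G \<and> generate G S = carrier G)"

definition torsion_free_group :: "('a, 'b) monoid_scheme \<Rightarrow> bool" where
  "torsion_free_group G \<longleftrightarrow>
     (\<forall>a\<in>carrier G. \<forall>n::nat. n \<ge> 1 \<longrightarrow> a [^]\<^bsub>G\<^esub> n = \<one>\<^bsub>G\<^esub> \<longrightarrow> a = \<one>\<^bsub>G\<^esub>)"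

definition commutator_subgroup :: "('a, 'b) monoid_scheme \<Rightarrow> 'a set \<Rightarrow> 'a set \<Rightarrow> 'a set" where
  "commutator_subgroup G H K =
     generate G (\<Union>h\<in>H. \<Union>k\<in>K. {h \<otimes>\<^bsub>G\<^esub> k \<otimes>\<^bsub>G\<^esub> inv\<^bsub>G\<^esub> h \<otimes>\<^bsub>G\<^esub> inv\<^bsub>G\<^esub> k})"

(* Indexed from 0, so that lower_central_series G c is trivial iff the class is at most c. *)
primrec lower_central_series :: "('a, 'b) monoid_scheme \<Rightarrow> nat \<Rightarrow> 'a set" where
  "lower_central_series G 0 = carrier G"
| "lower_central_series G (Suc n) = commutator_subgroup G (lower_central_series G n) (carrier G)"

definition nilpotent_group :: "('a, 'b) monoid_scheme \<Rightarrow> bool" where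
  "nilpotent_group G \<longleftrightarrow> (\<exists>c. lower_central_series G c = {\<one>\<^bsub>G\<^esub>})"

definition property_N :: "('a, 'b) monoid_scheme \<Rightarrow> bool" where
  "property_N G \<longleftrightarrow>
     (\<forall>a\<in>carrier G. \<forall>S. S \<subseteq> carrier G \<longrightarrow> finite S \<longrightarrow>
        (\<exists>n::nat. n \<ge> 1 \<and> a [^]\<^bsub>G\<^esub> n \<in> centraliser G S) \<longrightarrow> a \<in> centraliser G S)"

(* Closure under binary intersections gives all nonempty finite intersections; the empty
   intersection, i.e. the whole group G \<times>\<times> G, is not meant to be a member. *)
inductive_set diagonal_family :: "('a, 'b) monoid_scheme \<Rightarrow> ('a \<times> 'a) set set"
  for G (structure) where
  trivial: "{\<one>\<^bsub>G \<times>\<times> G\<^esub>} \<in> diagonal_family G"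
| diagonal: "{(a, a) |a. a \<in> carrier G} \<in> diagonal_family G"
| conjugate: "\<lbrakk>H \<in> diagonal_family G; g \<in> carrier (G \<times>\<times> G)\<rbrakk>
    \<Longrightarrow> g <#\<^bsub>G \<times>\<times> G\<^esub> H #>\<^bsub>G \<times>\<times> G\<^esub> inv\<^bsub>G \<times>\<times> G\<^esub> g \<in> diagonal_family G"
| inter: "\<lbrakk>H \<in> diagonal_family G; H' \<in> diagonal_family G\<rbrakk>
    \<Longrightarrow> H \<inter> H' \<in> diagonal_family G"

(* The set of cosets whose cardinality is the index [H : K], for subgroups K \<subseteq> H of G. *)
abbreviation cosets_within :: "('a, 'b) monoid_scheme \<Rightarrow> 'a set \<Rightarrow> 'a set \<Rightarrow> 'a set set" where
  "cosets_within G H K \<equiv> rcosets\<^bsub>G\<lparr>carrier := H\<rparr>\<^esub> K"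

definition principal_group :: "('a, 'b) monoid_scheme \<Rightarrow> bool" where
  "principal_group G \<longleftrightarrow>
     (\<forall>H\<in>diagonal_family G. \<forall>H'\<in>diagonal_family G.
        card (cosets_within (G \<times>\<times> G) H (H \<inter> H')) = 1 \<or>
        infinite (cosets_within (G \<times>\<times> G) H (H \<inter> H')))"

end

theory Submission
  imports Defs
begin

text \<open>
  In a torsion-free nilpotent group, commutation with a power forces commutation: if \<open>x\<^sup>n\<close> commutes
  with \<open>y\<close> in the \<open>i\<close>-th term of the lower central series, then it commutes with the commutator
  \<open>z = [y, x]\<close> one term further down, so \<open>x\<close> commutes with \<open>z\<close> by induction from the trivial end of the
  series, and \<open>x\<^sup>n = y x\<^sup>n y\<^sup>-\<^sup>1 = (z x)\<^sup>n = z\<^sup>n x\<^sup>n\<close> gives \<open>z = 1\<close>. Property N is this statement, and it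
  also implies that \<open>n\<close>-th roots are unique, i.e. that the diagonal contains every element one of
  whose powers it contains. This property is inherited by all members of the diagonal family, and a
  subgroup that has it is of index 1 or infinite in every group containing it.
\<close>

lemma (in group) conj_nat_pow:
  assumes "x \<in> carrier G" "g \<in> carrier G"
  shows "(g \<otimes> x \<otimes> inv g) [^] (n::nat) = g \<otimes> x [^] n \<otimes> inv g"
proof (induction n)
  case (Suc n)
  have "inv g \<otimes> (g \<otimes> (x \<otimes> inv g)) = x \<otimes> inv g"
    using assms by (simp flip: m_assoc)
  then show ?case using Suc assms by (simp add: m_assoc)
qed (use assms in simp)

lemma (in group) lower_central_series_subset:
  "lower_central_series G i \<subseteq> carrier G"
proof (induction i)
  case (Suc i)
  then show ?case
    unfolding lower_central_series.simps commutator_subgroup_def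
    by (intro generate_incl) auto
qed simp

text \<open>Induction on \<open>k\<close>, the distance from term \<open>i\<close> to the trivial
  term. Both \<open>i\<close> and \<open>y\<close> stay arbitrary because the step passes from
  \<open>y\<close> to a commutator in term \<open>Suc i\<close>, one unit nearer the end.\<close>

lemma (in group) commute_of_pow_commute_lower_central_series:
  assumes tf: "torsion_free_group G"
    and triv: "lower_central_series G (i + k) = {\<one>}"
    and y: "y \<in> lower_central_series G i"
    and x: "x \<in> carrier G" and n: "n \<ge> (1::nat)"
    and comm: "x [^] n \<otimes> y = y \<otimes> x [^] n"
  shows "x \<otimes> y = y \<otimes> x"
  using triv y comm
proof (induction k arbitrary: i y)
  case 0
  then show ?case using x by simp
next
  case (Suc k)
  have yc: "y \<in> carrier G" using Suc.prems lower_central_series_subset by blast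
  define z where "z = y \<otimes> x \<otimes> inv y \<otimes> inv x"
  have zc: "z \<in> carrier G" using yc x by (simp add: z_def)
  have z_lcs: "z \<in> lower_central_series G (Suc i)"
    unfolding lower_central_series.simps commutator_subgroup_def z_def
    using Suc.prems(2) x by (intro generate.incl) auto
  have conj_eq: "y \<otimes> x \<otimes> inv y = z \<otimes> x"
    using yc x by (simp add: z_def m_assoc)
  have conj_pow: "y \<otimes> x [^] n \<otimes> inv y = x [^] n"
    using Suc.prems(3) yc x by (metis inv_solve_right' m_closed nat_pow_closed)
  have pow_x: "x [^] n \<otimes> x = x \<otimes> x [^] n"
    using x by (metis nat_pow_Suc nat_pow_Suc2)
  \<comment> \<open>The elements commuting with \<open>x [^] n\<close> are closed under products and
    inverses, and \<open>z\<close> is a word in \<open>y\<close> and \<open>x\<close>.\<close>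
  have "x [^] n \<otimes> z = z \<otimes> x [^] n"
  proof -
    have c: "x [^] n \<otimes> (a \<otimes> b) = (a \<otimes> b) \<otimes> x [^] n"
      if "a \<in> carrier G" "b \<in> carrier G" "x [^] n \<otimes> a = a \<otimes> x [^] n" "x [^] n \<otimes> b = b \<otimes> x [^] n" for a b
      using that x by (metis m_assoc nat_pow_closed)
    have i: "x [^] n \<otimes> inv a = inv a \<otimes> x [^] n"
      if "a \<in> carrier G" "x [^] n \<otimes> a = a \<otimes> x [^] n" for a
      using that x by (metis inv_closed inv_solve_left inv_solve_right m_assoc m_closed nat_pow_closed)
    show ?thesis unfolding z_def
      using yc x by (intro c i m_closed inv_closed Suc.prems(3) pow_x)
  qed
  then have "x \<otimes> z = z \<otimes> x"
    using Suc.IH[of "Suc i" z] Suc.prems(1) z_lcs by simp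
  then have "z [^] n \<otimes> x [^] n = (z \<otimes> x) [^] n"
    using pow_mult_distrib[of z x n] zc x by simp
  also have "\<dots> = x [^] n"
    using conj_nat_pow[OF x yc, of n] conj_eq conj_pow by simp
  finally have "z [^] n = \<one>"
    using zc x by (metis l_one nat_pow_closed one_closed r_cancel)
  then have "z = \<one>" using tf zc n by (auto simp: torsion_free_group_def)
  then show ?case using conj_eq yc x by (metis inv_solve_right' l_one m_closed)
qed

lemma (in group) commute_of_pow_commute:
  assumes "torsion_free_group G" "nilpotent_group G"
    and "x \<in> carrier G" "y \<in> carrier G" "n \<ge> (1::nat)"
    and "x [^] n \<otimes> y = y \<otimes> x [^] n"
  shows "x \<otimes> y = y \<otimes> x"
proof -
  obtain c where "lower_central_series G c = {\<one>}"
    using assms(2) by (auto simp: nilpotent_group_def)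
  then show ?thesis
    using commute_of_pow_commute_lower_central_series[of 0 c y x n] assms by simp
qed

text \<open>The common power commutes with \<open>b\<close>, hence so does \<open>a\<close>; then
  \<open>a \<otimes> inv b\<close> has trivial \<open>n\<close>-th power and torsion-freeness
  applies.\<close>

lemma (in group) root_unique:
  assumes "torsion_free_group G" "nilpotent_group G"
    and a: "a \<in> carrier G" and b: "b \<in> carrier G" and n: "n \<ge> (1::nat)"
    and eq: "a [^] n = b [^] n"
  shows "a = b"
proof -
  have "a [^] n \<otimes> b = b \<otimes> a [^] n"
    unfolding eq using b by (metis nat_pow_Suc nat_pow_Suc2)
  then have "a \<otimes> b = b \<otimes> a" using assms commute_of_pow_commute by blast
  then have "a \<otimes> inv b = inv b \<otimes> a"
    using a b by (metis inv_closed inv_solve_left inv_solve_right m_assoc m_closed)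
  then have "(a \<otimes> inv b) [^] n = a [^] n \<otimes> inv b [^] n"
    using pow_mult_distrib[of a "inv b" n] a b by simp
  also have "\<dots> = \<one>"
    using eq a b by (simp add: nat_pow_inv)
  finally have "a \<otimes> inv b = \<one>"
    using assms(1) a b n by (auto simp: torsion_free_group_def)
  then show ?thesis using a b by (metis inv_solve_right' l_one one_closed)
qed

text \<open>Being closed under roots survives conjugation and intersection, so the members of
  \<open>diagonal_family\<close> can be handled without describing them by centralisers.\<close>

definition isolated_subgroup :: "('a, 'b) monoid_scheme \<Rightarrow> 'a set \<Rightarrow> bool" where
  "isolated_subgroup G H \<longleftrightarrow> subgroup H G \<and>
     (\<forall>x\<in>carrier G. \<forall>n::nat. n \<ge> 1 \<longrightarrow> x [^]\<^bsub>G\<^esub> n \<in> H \<longrightarrow> x \<in> H)"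

text \<open>Conjugation commutes with powers, so a root of an element of the conjugate is carried
  back by \<open>inv g\<close> to a root of an element of \<open>H\<close>.\<close>

lemma (in group) isolated_subgroup_conj:
  assumes H: "isolated_subgroup G H" and g: "g \<in> carrier G"
  shows "isolated_subgroup G (g <# H #> inv g)"
proof -
  have sub: "subgroup H G" and Hc: "H \<subseteq> carrier G"
    using H subgroup.subset by (auto simp: isolated_subgroup_def)
  have mem: "x \<in> g <# H #> inv g \<longleftrightarrow> inv g \<otimes> x \<otimes> g \<in> H" if "x \<in> carrier G" for x
  proof
    assume "x \<in> g <# H #> inv g"
    then obtain h where h: "h \<in> H" "x = g \<otimes> h \<otimes> inv g"
      by (auto simp: l_coset_def r_coset_def)
    then have "inv g \<otimes> x \<otimes> g = h"
      using g Hc by (auto simp: m_assoc inv_solve_left' subset_iff)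
    then show "inv g \<otimes> x \<otimes> g \<in> H" using h by simp
  next
    assume a: "inv g \<otimes> x \<otimes> g \<in> H"
    have "x = g \<otimes> (inv g \<otimes> x \<otimes> g) \<otimes> inv g"
      using g that by (simp add: inv_solve_right m_assoc) (simp flip: m_assoc)
    then show "x \<in> g <# H #> inv g"
      using a by (auto simp: l_coset_def r_coset_def)
  qed
  have "x \<in> g <# H #> inv g"
    if x: "x \<in> carrier G" and n: "n \<ge> 1" and p: "x [^] n \<in> g <# H #> inv g" for x and n :: nat
  proof -
    have "(inv g \<otimes> x \<otimes> g) [^] n = inv g \<otimes> x [^] n \<otimes> g"
      using conj_nat_pow[of x "inv g" n] x g by simp
    then have "(inv g \<otimes> x \<otimes> g) [^] n \<in> H" using mem p x by simp
    then have "inv g \<otimes> x \<otimes> g \<in> H"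
      using H x g n by (auto simp: isolated_subgroup_def)
    then show ?thesis using mem x by simp
  qed
  then show ?thesis
    using subgroup_conjugation_is_surj2 sub g by (auto simp: isolated_subgroup_def)
qed

lemma (in group) nat_pow_DirProd:
  "(a, b) [^]\<^bsub>G \<times>\<times> G\<^esub> (n::nat) = (a [^] n, b [^] n)"
  by (induction n) auto

lemma (in group) diagonal_family_isolated:
  assumes tf: "torsion_free_group G" and nil: "nilpotent_group G"
    and H: "H \<in> diagonal_family G"
  shows "isolated_subgroup (G \<times>\<times> G) H"
proof -
  interpret P: group "G \<times>\<times> G" by (intro DirProd_group is_group)
  show ?thesis using H
  proof (induction rule: diagonal_family.induct)
    case trivial
    \<comment> \<open>A pair with trivial \<open>n\<close>-th power is trivial, by torsion-freeness
      in each coordinate.\<close>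
    then show ?case
      using tf by (auto simp: isolated_subgroup_def P.triv_subgroup nat_pow_DirProd torsion_free_group_def
          simp del: one_DirProd) (auto simp: torsion_free_group_def)
  next
    case diagonal
    have "subgroup {(a, a) |a. a \<in> carrier G} (G \<times>\<times> G)"
      by (intro P.subgroupI) auto
    \<comment> \<open>A power of \<open>(a, b)\<close> on the diagonal means that \<open>a\<close>
      and \<open>b\<close> have equal \<open>n\<close>-th powers.\<close>
    then show ?case
      using root_unique[OF tf nil] by (auto simp: isolated_subgroup_def nat_pow_DirProd)
  next
    case (conjugate H g)
    then show ?case using P.isolated_subgroup_conj by blast
  next
    case (inter H H')
    then show ?case by (auto simp: isolated_subgroup_def P.subgroups_Inter_pair)
  qed
qed

text \<open>Pigeonhole: with finitely many cosets, two powers of any \<open>x\<close> share a coset,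
  so a positive power of \<open>x\<close> lies in \<open>K\<close>, and therefore \<open>x\<close>
  does.\<close>

lemma (in group) isolated_subgroup_finite_index:
  assumes K: "isolated_subgroup G K" and fin: "finite (rcosets K)"
  shows "K = carrier G"
proof -
  have sub: "subgroup K G" using K by (simp add: isolated_subgroup_def)
  have "x \<in> K" if x: "x \<in> carrier G" for x
  proof -
    have "range (\<lambda>i::nat. K #> x [^] i) \<subseteq> rcosets K"
      using x by (auto simp: RCOSETS_def)
    then have "\<not> inj (\<lambda>i::nat. K #> x [^] i)"
      using fin finite_subset range_inj_infinite by metis
    then obtain i j :: nat where ij: "i < j" "K #> x [^] i = K #> x [^] j"
      unfolding inj_def by (metis linorder_neqE_nat)
    have "x [^] j \<in> K #> x [^] i"
      using ij sub x by (simp add: rcos_self)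
    then obtain h where h: "h \<in> K" "x [^] j = h \<otimes> x [^] i" by (auto simp: r_coset_def)
    have "x [^] (j - i) \<otimes> x [^] i = x [^] j" using ij x by (simp add: nat_pow_mult)
    then have "x [^] (j - i) = h"
      using h x sub by (metis nat_pow_closed r_cancel subgroup.mem_carrier)
    moreover have "j - i \<ge> 1" using ij by simp
    ultimately show "x \<in> K" using K x h unfolding isolated_subgroup_def by blast
  qed
  then show ?thesis using sub subgroup.subset by blast
qed

lemma (in group) card_rcosets_carrier: "card (rcosets (carrier G)) = 1"
proof -
  have "rcosets (carrier G) = {carrier G}"
    using coset_join2[OF _ subgroup_self] by (auto simp: RCOSETS_def)
  then show ?thesis by simp
qed

text \<open>The intersection is isolated inside \<open>H\<close> taken as a group of its own, so
  finite index there forces it to be all of \<open>H\<close>.\<close>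

lemma (in group) isolated_subgroup_index:
  assumes H: "subgroup H G" and K: "isolated_subgroup G K"
  shows "card (cosets_within G H (H \<inter> K)) = 1 \<or> infinite (cosets_within G H (H \<inter> K))"
proof -
  interpret A: group "G\<lparr>carrier := H\<rparr>" using H by (rule subgroup_imp_group)
  have "subgroup (H \<inter> K) (G\<lparr>carrier := H\<rparr>)"
    using H K by (intro subgroup_incl subgroups_Inter_pair) (auto simp: isolated_subgroup_def)
  then have "isolated_subgroup (G\<lparr>carrier := H\<rparr>) (H \<inter> K)"
    using K subgroup.subset[OF H] by (auto simp: isolated_subgroup_def simp flip: nat_pow_consistent)
  then show ?thesis
    using A.isolated_subgroup_finite_index[of "H \<inter> K"] A.card_rcosets_carrier by auto
qed

theorem proposition8p0p3:
  fixes G :: "('a, 'b) monoid_scheme"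
  assumes "group G"
    and "finitely_generated_group G"
    and "torsion_free_group G"
    and "nilpotent_group G"
  shows "property_N G \<and> principal_group G"
proof
  interpret group G by fact
  interpret P: group "G \<times>\<times> G" by (intro DirProd_group is_group)
  \<comment> \<open>The centraliser condition is checked one element of \<open>S\<close> at a time,
    with the same exponent \<open>n\<close>.\<close>
  show "property_N G"
    using commute_of_pow_commute[OF assms(3,4)]
    unfolding property_N_def centraliser_def by blast
  have "isolated_subgroup (G \<times>\<times> G) H" if "H \<in> diagonal_family G" for H
    using diagonal_family_isolated assms(3,4) that .
  then show "principal_group G"
    unfolding principal_group_def
    by (intro ballI P.isolated_subgroup_index) (auto simp: isolated_subgroup_def)
qed

end
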